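(* Let $E$ be a nonempty locally compact Borel space, $P(x,dy)$ a transition probability function on $E$, $\nu$ a probability measure on $\mathcal{B}(E)$, $p\in(0,1)$, and $H\in\mathcal{B}(E)$. Consider the equation, for measurable functions $V:E\to[0,\infty]$, $$V(x) = 1 + p \int_E V(y)\, \nu(dy) + (1-p)\int_E V(y)\, {}_H P(x,dy)\quad \forall\, x\in E\setminus H,\qquad V(x)=0\quad \forall\, x\in H. \qquad (\ast)$$ (a) The minimal nonnegative (measurable, $[0,\infty]$-valued) solution $V$ to $(\ast)$ is given explicitly by $$V(x) = V_1(x)\sum_{t=0}^\infty \left(p\int_{E} V_1(y)\,\nu(dy)\right)^t\quad \forall\, x\in E\setminus H,\qquad V(x)=0\quad\forall\, x\in H,$$ where the function $V_1$ is given by $$V_1(x) := \sum_{t=0}^\infty (1-p)^t\, {}_H P^t(x,E)\quad \forall\, x\in E\setminus H,\qquad V_1(x):=0\quad \forall\, x\in H.$$ The function $V_1$ coincides with the unique bounded (measurable) solution to the equation $$V_1(x)=1+(1-p)\int_E V_1(y)\, {}_H P(x,dy)\quad \forall\, x\in E\setminus H,\qquad V_1(x)=0\quad \forall\, x\in H.$$ (b) If $q(H)>0$, then $$V(x) = \frac{V_1(x)}{1 - p\int_{E} V_1(y)\,\nu(dy)}<\infty\quad \forall\, x\in E\setminus H,\qquad V(x)=0\quad \forall\, x\in H.$$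
   Context: The taboo kernel with respect to $H$ is ${}_H P(x,\Gamma):=P(x,\Gamma\setminus H)$ for $x\in E$, $\Gamma\in\mathcal{B}(E)$. Its powers are defined iteratively by ${}_HP^0(x,\Gamma):=I\{x\in\Gamma\setminus H\}$ (so ${}_H P^0(x,E)=I\{x\in E\setminus H\}$) and ${}_HP^{t+1}(x,\Gamma):=\int_E {}_HP^{t}(x,dy)\,{}_HP(y,\Gamma)$. The powers of $P$ are $P^0(x,\Gamma):=I\{x\in\Gamma\}$, $P^{t+1}(x,\Gamma):=\int_E P^t(x,dy)P(y,\Gamma)$. The process with restart $\tilde X=\{\tilde X_t,\ t=0,1,\dots\}$ is the Markov chain on $E$ with transition probability function $\tilde P(x,\Gamma):=p\,\nu(\Gamma)+(1-p)P(x,\Gamma)$. The probability measure $q$ is its unique invariant probability measure, given by $$q(\Gamma)=\int_E \sum_{t=0}^\infty p(1-p)^t P^t(y,\Gamma)\,\nu(dy),\qquad \Gamma\in\mathcal{B}(E).$$ With $\eta_H:=\inf\{t=0,1,\dots:\tilde X_t\in H\}$ ($\inf\emptyset:=\infty$), it is well known that the expected hitting time $V(x)=E_x[\eta_H]$ is the minimal nonnegative solution of $(\ast)$. "Minimal" means pointwise smallest. Convention: $0\cdot(+\infty):=0$. *)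

theory Defs
  imports "HOL-Probability.Probability"
begin

text \<open>
  A measurable space is represented by a measure \<open>M\<close> of which only \<open>space M\<close> and \<open>sets M\<close> matter.
  A transition probability function on it is an element of \<open>M \<rightarrow>\<^sub>M prob_algebra M\<close>, a substochastic
  one an element of \<open>M \<rightarrow>\<^sub>M subprob_algebra M\<close>.
\<close>

text \<open>The taboo kernel; see \<open>emeasure_taboo\<close> for the form \<open>P(x, \<Gamma> - H)\<close>.\<close>

definition taboo :: "'a set \<Rightarrow> ('a \<Rightarrow> 'a measure) \<Rightarrow> 'a \<Rightarrow> 'a measure" where
  "taboo H P x = density (P x) (indicator (- H))"

text \<open>The iterated integrals defining the powers are written with the Giry monad; see
  \<open>emeasure_kernel_pow_Suc\<close> and \<open>emeasure_taboo_pow_Suc\<close>. The zeroth taboo power is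
  \<open>I{x \<in> \<Gamma> - H}\<close>, that is, the null measure for \<open>x \<in> H\<close>.\<close>

primrec kernel_pow :: "'a measure \<Rightarrow> ('a \<Rightarrow> 'a measure) \<Rightarrow> nat \<Rightarrow> 'a \<Rightarrow> 'a measure" where
  "kernel_pow M P 0 = return M"
| "kernel_pow M P (Suc t) = (\<lambda>x. kernel_pow M P t x \<bind> P)"

primrec taboo_pow :: "'a measure \<Rightarrow> 'a set \<Rightarrow> ('a \<Rightarrow> 'a measure) \<Rightarrow> nat \<Rightarrow> 'a \<Rightarrow> 'a measure" where
  "taboo_pow M H P 0 = taboo H (return M)"
| "taboo_pow M H P (Suc t) = (\<lambda>x. taboo_pow M H P t x \<bind> taboo H P)"

text \<open>The invariant probability measure \<open>q\<close> of the process with restart, by its explicit formula;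
  see \<open>emeasure_restart_measure\<close>.\<close>

definition restart_measure ::
    "'a measure \<Rightarrow> ('a \<Rightarrow> 'a measure) \<Rightarrow> 'a measure \<Rightarrow> real \<Rightarrow> 'a measure" where
  "restart_measure M P \<nu> p = measure_of (space M) (sets M)
     (\<lambda>\<Gamma>. \<integral>\<^sup>+ y. (\<Sum>t. ennreal (p * (1 - p) ^ t) * emeasure (kernel_pow M P t y) \<Gamma>) \<partial>\<nu>)"

definition hitting_equation ::
    "'a measure \<Rightarrow> 'a set \<Rightarrow> ('a \<Rightarrow> 'a measure) \<Rightarrow> 'a measure \<Rightarrow> real \<Rightarrow> ('a \<Rightarrow> ennreal) \<Rightarrow> bool" where
  "hitting_equation M H P \<nu> p V \<longleftrightarrow>
     (\<forall>x\<in>space M - H. V x = 1 + ennreal p * (\<integral>\<^sup>+ y. V y \<partial>\<nu>)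
                           + ennreal (1 - p) * (\<integral>\<^sup>+ y. V y \<partial>taboo H P x)) \<and>
     (\<forall>x\<in>H. V x = 0)"

definition minimal_solution ::
    "'a measure \<Rightarrow> 'a set \<Rightarrow> ('a \<Rightarrow> 'a measure) \<Rightarrow> 'a measure \<Rightarrow> real \<Rightarrow> ('a \<Rightarrow> ennreal) \<Rightarrow> bool" where
  "minimal_solution M H P \<nu> p V \<longleftrightarrow>
     V \<in> borel_measurable M \<and> hitting_equation M H P \<nu> p V \<and>
     (\<forall>W. W \<in> borel_measurable M \<and> hitting_equation M H P \<nu> p W \<longrightarrow> (\<forall>x\<in>space M. V x \<le> W x))"

text \<open>Bounded solutions may a priori take negative values, hence the Bochner integral.\<close>

definition bounded_solution ::
    "'a measure \<Rightarrow> 'a set \<Rightarrow> ('a \<Rightarrow> 'a measure) \<Rightarrow> real \<Rightarrow> ('a \<Rightarrow> real) \<Rightarrow> bool" where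
  "bounded_solution M H P p W \<longleftrightarrow>
     W \<in> borel_measurable M \<and> bounded (W ` space M) \<and>
     (\<forall>x\<in>space M - H. W x = 1 + (1 - p) * (\<integral>y. W y \<partial>taboo H P x)) \<and>
     (\<forall>x\<in>H. W x = 0)"

definition V1 :: "'a measure \<Rightarrow> 'a set \<Rightarrow> ('a \<Rightarrow> 'a measure) \<Rightarrow> real \<Rightarrow> 'a \<Rightarrow> ennreal" where
  "V1 M H P p x =
     (if x \<in> H then 0
      else (\<Sum>t. ennreal ((1 - p) ^ t) * emeasure (taboo_pow M H P t x) (space M)))"

definition V_explicit ::
    "'a measure \<Rightarrow> 'a set \<Rightarrow> ('a \<Rightarrow> 'a measure) \<Rightarrow> 'a measure \<Rightarrow> real \<Rightarrow> 'a \<Rightarrow> ennreal" where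
  "V_explicit M H P \<nu> p x =
     (if x \<in> H then 0
      else V1 M H P p x * (\<Sum>t. (ennreal p * (\<integral>\<^sup>+ y. V1 M H P p y \<partial>\<nu>)) ^ t))"

lemma emeasure_taboo:
  assumes P: "P \<in> M \<rightarrow>\<^sub>M subprob_algebra M" and H: "H \<in> sets M"
    and x: "x \<in> space M" and \<Gamma>: "\<Gamma> \<in> sets M"
  shows "emeasure (taboo H P x) \<Gamma> = emeasure (P x) (\<Gamma> - H)"
proof -
  have s: "sets (P x) = sets M" using P x by (rule sets_kernel)
  have sp: "space (P x) = space M" using s by (rule sets_eq_imp_space_eq)
  have "- H \<inter> space (P x) \<in> sets (P x)"
    using H s sp by (metis Diff_eq Int_commute sets.compl_sets)
  then have m: "(indicator (- H) :: _ \<Rightarrow> ennreal) \<in> borel_measurable (P x)"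
    by (simp add: borel_measurable_indicator_iff)
  have "emeasure (taboo H P x) \<Gamma> = (\<integral>\<^sup>+ y. indicator (- H) y * indicator \<Gamma> y \<partial>P x)"
    unfolding taboo_def using m \<Gamma> s by (intro emeasure_density) auto
  also have "\<dots> = (\<integral>\<^sup>+ y. indicator (\<Gamma> - H) y \<partial>P x)"
    by (intro nn_integral_cong) (auto split: split_indicator)
  also have "\<dots> = emeasure (P x) (\<Gamma> - H)"
    using \<Gamma> H s by (intro nn_integral_indicator) auto
  finally show ?thesis .
qed

lemma measurable_taboo:
  assumes P: "P \<in> M \<rightarrow>\<^sub>M subprob_algebra M" and H: "H \<in> sets M"
  shows "taboo H P \<in> M \<rightarrow>\<^sub>M subprob_algebra M"
proof (rule measurable_subprob_algebra)
  fix x assume x: "x \<in> space M"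
  have s: "sets (P x) = sets M" using P x by (rule sets_kernel)
  have sp: "space (P x) = space M" using s by (rule sets_eq_imp_space_eq)
  interpret P: subprob_space "P x" using P x by (rule subprob_space_kernel)
  show "sets (taboo H P x) = sets M" by (simp add: taboo_def s)
  have spt: "space (taboo H P x) = space M" by (simp add: taboo_def sp)
  show "subprob_space (taboo H P x)"
  proof (rule subprob_spaceI)
    show "emeasure (taboo H P x) (space (taboo H P x)) \<le> 1"
      unfolding spt emeasure_taboo[OF P H x sets.top] by (rule P.subprob_emeasure_le_1)
    show "space (taboo H P x) \<noteq> {}" using x spt by auto
  qed
next
  fix \<Gamma> assume "\<Gamma> \<in> sets M"
  with H have "(\<lambda>x. emeasure (P x) (\<Gamma> - H)) \<in> borel_measurable M"
    by (intro measurable_emeasure_kernel[OF P]) auto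
  then show "(\<lambda>x. emeasure (taboo H P x) \<Gamma>) \<in> borel_measurable M"
    using emeasure_taboo[OF P H _ \<open>\<Gamma> \<in> sets M\<close>] by (simp cong: measurable_cong)
qed

lemma measurable_kernel_pow:
  assumes "P \<in> M \<rightarrow>\<^sub>M subprob_algebra M"
  shows "kernel_pow M P t \<in> M \<rightarrow>\<^sub>M subprob_algebra M"
  by (induction t) (auto intro: return_measurable measurable_bind2[OF _ assms])

lemma emeasure_kernel_pow_0:
  assumes "\<Gamma> \<in> sets M"
  shows "emeasure (kernel_pow M P 0 x) \<Gamma> = indicator \<Gamma> x"
  using assms by simp

lemma emeasure_kernel_pow_Suc:
  assumes P: "P \<in> M \<rightarrow>\<^sub>M subprob_algebra M" and x: "x \<in> space M" and \<Gamma>: "\<Gamma> \<in> sets M"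
  shows "emeasure (kernel_pow M P (Suc t) x) \<Gamma> =
    (\<integral>\<^sup>+ y. emeasure (P y) \<Gamma> \<partial>kernel_pow M P t x)"
proof -
  have s: "sets (kernel_pow M P t x) = sets M"
    using measurable_kernel_pow[OF P] x by (rule sets_kernel)
  have "space (kernel_pow M P t x) \<noteq> {}" using sets_eq_imp_space_eq[OF s] x by auto
  moreover have "P \<in> kernel_pow M P t x \<rightarrow>\<^sub>M subprob_algebra M"
    using P s by (simp cong: measurable_cong_sets)
  ultimately show ?thesis using \<Gamma> by (simp add: emeasure_bind)
qed

lemma measurable_taboo_pow:
  assumes "P \<in> M \<rightarrow>\<^sub>M subprob_algebra M" and "H \<in> sets M"
  shows "taboo_pow M H P t \<in> M \<rightarrow>\<^sub>M subprob_algebra M"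
  by (induction t)
    (auto intro: measurable_taboo return_measurable assms measurable_bind2[OF _ measurable_taboo[OF assms]])

lemma emeasure_taboo_pow_0:
  assumes "H \<in> sets M" and "x \<in> space M" and "\<Gamma> \<in> sets M"
  shows "emeasure (taboo_pow M H P 0 x) \<Gamma> = indicator (\<Gamma> - H) x"
  using emeasure_taboo[OF return_measurable assms] assms by simp

lemma emeasure_taboo_pow_Suc:
  assumes P: "P \<in> M \<rightarrow>\<^sub>M subprob_algebra M" and H: "H \<in> sets M"
    and x: "x \<in> space M" and \<Gamma>: "\<Gamma> \<in> sets M"
  shows "emeasure (taboo_pow M H P (Suc t) x) \<Gamma> =
    (\<integral>\<^sup>+ y. emeasure (taboo H P y) \<Gamma> \<partial>taboo_pow M H P t x)"
proof -
  have s: "sets (taboo_pow M H P t x) = sets M"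
    using measurable_taboo_pow[OF P H] x by (rule sets_kernel)
  have "space (taboo_pow M H P t x) \<noteq> {}" using sets_eq_imp_space_eq[OF s] x by auto
  moreover have "taboo H P \<in> taboo_pow M H P t x \<rightarrow>\<^sub>M subprob_algebra M"
    using measurable_taboo[OF P H] s by (simp cong: measurable_cong_sets)
  ultimately show ?thesis using \<Gamma> by (simp add: emeasure_bind)
qed

lemma emeasure_restart_measure:
  assumes P: "P \<in> M \<rightarrow>\<^sub>M subprob_algebra M" and \<nu>: "sets \<nu> = sets M" and \<Gamma>: "\<Gamma> \<in> sets M"
  shows "emeasure (restart_measure M P \<nu> p) \<Gamma> =
    (\<integral>\<^sup>+ y. (\<Sum>t. ennreal (p * (1 - p) ^ t) * emeasure (kernel_pow M P t y) \<Gamma>) \<partial>\<nu>)"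
  unfolding restart_measure_def
proof (rule emeasure_measure_of_sigma[OF sets.sigma_algebra_axioms _ _ \<Gamma>])
  let ?\<mu> = "\<lambda>\<Gamma>. \<integral>\<^sup>+ y. (\<Sum>t. ennreal (p * (1 - p) ^ t) * emeasure (kernel_pow M P t y) \<Gamma>) \<partial>\<nu>"
  show "positive (sets M) ?\<mu>" by (simp add: positive_def)
  show "countably_additive (sets M) ?\<mu>"
  proof (rule countably_additiveI)
    fix A :: "nat \<Rightarrow> 'a set"
    assume A: "range A \<subseteq> sets M" "disjoint_family A" "\<Union> (range A) \<in> sets M"
    have meas: "(\<lambda>y. \<Sum>t. ennreal (p * (1 - p) ^ t) * emeasure (kernel_pow M P t y) (A i))
        \<in> borel_measurable \<nu>" for i
    proof -
      have "(\<lambda>y. emeasure (kernel_pow M P t y) (A i)) \<in> borel_measurable \<nu>" for t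
        using measurable_emeasure_kernel[OF measurable_kernel_pow[OF P], of "A i" t] A(1) \<nu>
        by (auto cong: measurable_cong_sets)
      then show ?thesis by measurable
    qed
    have "(\<Sum>i. ?\<mu> (A i)) =
      (\<integral>\<^sup>+ y. (\<Sum>i. \<Sum>t. ennreal (p * (1 - p) ^ t) * emeasure (kernel_pow M P t y) (A i)) \<partial>\<nu>)"
      by (intro nn_integral_suminf[symmetric] meas)
    also have "\<dots> = ?\<mu> (\<Union> (range A))"
    proof (rule nn_integral_cong)
      fix y assume "y \<in> space \<nu>"
      then have y: "y \<in> space M" using sets_eq_imp_space_eq[OF \<nu>] by simp
      have "range A \<subseteq> sets (kernel_pow M P t y)" for t
        using A(1) sets_kernel[OF measurable_kernel_pow[OF P] y] by simp
      then have e: "(\<Sum>i. emeasure (kernel_pow M P t y) (A i)) =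
          emeasure (kernel_pow M P t y) (\<Union> (range A))" for t
        using A(2) by (intro suminf_emeasure)
      have "(\<Sum>i. \<Sum>t. ennreal (p * (1 - p) ^ t) * emeasure (kernel_pow M P t y) (A i)) =
        (\<Sum>t. \<Sum>i. ennreal (p * (1 - p) ^ t) * emeasure (kernel_pow M P t y) (A i))"
        by (subst (1 2) nn_integral_count_space_nat[symmetric]) (simp add: nn_integral_suminf)
      also have "\<dots> = (\<Sum>t. ennreal (p * (1 - p) ^ t) * emeasure (kernel_pow M P t y) (\<Union> (range A)))"
        by (simp add: e)
      finally show "(\<Sum>i. \<Sum>t. ennreal (p * (1 - p) ^ t) * emeasure (kernel_pow M P t y) (A i)) =
        (\<Sum>t. ennreal (p * (1 - p) ^ t) * emeasure (kernel_pow M P t y) (\<Union> (range A)))" .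
    qed
    finally show "(\<Sum>i. ?\<mu> (A i)) = ?\<mu> (\<Union> (range A))" .
  qed
qed

end

theory Submission
  imports Defs
begin

text \<open>
  Splitting off the first step of the taboo chain shows that \<open>V\<^sub>1\<close> solves its equation, and
  iterating the inequality \<open>W \<ge> b + (1 - p) K W\<close> off \<open>H\<close>, where \<open>K\<close> is the taboo kernel, yields
  \<open>W \<ge> b V\<^sub>1\<close>. For a solution \<open>W\<close> of the hitting equation take \<open>b = 1 + p \<nu>(W)\<close>. Then
  \<open>b \<ge> 1 + b m\<close> with \<open>m = p \<nu>(V\<^sub>1)\<close>, so that \<open>b\<close> dominates the geometric series of \<open>m\<close>: this is
  minimality. Bounded solutions are unique because \<open>(1 - p) K\<close> is a contraction in the supremum
  norm. For (b), the mass of the \<open>t\<close>-th taboo power is at most \<open>P\<^sup>t(y, E - H)\<close>, whence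
  \<open>q(H) + m \<le> 1\<close> and the geometric series converges.
\<close>

section \<open>Extended nonnegative series and integrals against subprobabilities\<close>

lemma suminf_geometric_ennreal:
  fixes m :: ennreal
  assumes "m < 1"
  shows "(\<Sum>t. m ^ t) = 1 / (1 - m)"
proof -
  obtain r where r: "0 \<le> r" "m = ennreal r" "r < 1"
    using assms by (cases m) (auto simp: ennreal_less_one_iff)
  have "(\<Sum>t. m ^ t) = (\<Sum>t. ennreal (r ^ t))"
    using r by (simp add: ennreal_power)
  also have "\<dots> = ennreal (1 / (1 - r))"
    using r geometric_sums[of r] by (intro suminf_ennreal_eq) auto
  also have "\<dots> = ennreal 1 / ennreal (1 - r)"
    using r by (simp add: divide_ennreal del: ennreal_1)
  also have "ennreal (1 - r) = 1 - m"
    using r by (simp add: ennreal_minus flip: ennreal_1)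
  finally show ?thesis by simp
qed

text \<open>An extended nonnegative series is the supremum of its partial sums. Both minimality
  arguments bound partial sums by induction and pass to the limit here.\<close>

lemma suminf_le_ennreal:
  fixes f :: "nat \<Rightarrow> ennreal"
  assumes "\<And>n. (\<Sum>t<n. f t) \<le> b"
  shows "(\<Sum>t. f t) \<le> b"
  using assms by (simp add: suminf_eq_SUP SUP_le_iff)

text \<open>Averaging against total mass at most 1 cannot increase a bound on the absolute value;
  the total mass only scales \<open>B\<close> down. This drives the contraction estimate for bounded
  solutions.\<close>

lemma integral_subprob_le:
  fixes f :: "'a \<Rightarrow> real"
  assumes "subprob_space N" and "f \<in> borel_measurable N"
    and "\<And>x. x \<in> space N \<Longrightarrow> \<bar>f x\<bar> \<le> B" and "0 \<le> B"
  shows "integrable N f" and "\<bar>\<integral>x. f x \<partial>N\<bar> \<le> B"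
proof -
  interpret subprob_space N by fact
  show i: "integrable N f"
    using assms by (intro integrable_const_bound[where B=B]) auto
  have "\<bar>\<integral>x. f x \<partial>N\<bar> \<le> (\<integral>x. \<bar>f x\<bar> \<partial>N)"
    by (rule integral_abs_bound)
  also have "\<dots> \<le> (\<integral>x. B \<partial>N)"
    using i assms by (intro integral_mono) auto
  also have "\<dots> \<le> B"
    using subprob_measure_le_1[of "space N"] assms by (simp add: mult_left_le_one_le)
  finally show "\<bar>\<integral>x. f x \<partial>N\<bar> \<le> B" .
qed

section \<open>The taboo chain with discount factor 1 - p\<close>

locale restart_chain =
  fixes M :: "'a measure" and H :: "'a set" and P :: "'a \<Rightarrow> 'a measure" and p :: real
  assumes P: "P \<in> M \<rightarrow>\<^sub>M subprob_algebra M" and H: "H \<in> sets M"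
    and p0: "0 < p" and p1: "p < 1"
begin

abbreviation "K \<equiv> taboo H P"
abbreviation "T \<equiv> taboo_pow M H P"
abbreviation "c \<equiv> ennreal (1 - p)"
text \<open>Inside the locale \<open>V\<close> stands for V_1 of the statement; the minimal solution
  of the hitting equation is \<open>V_explicit\<close>.\<close>

abbreviation "V \<equiv> V1 M H P p"

text \<open>For a stochastic \<open>P\<close> this is the probability that the chain started at
  \<open>x\<close> avoids \<open>H\<close> at all times 0, ..., t.\<close>

definition mass :: "nat \<Rightarrow> 'a \<Rightarrow> ennreal" where
  "mass t x = emeasure (T t x) (space M)"

lemmas K_kernel = measurable_taboo[OF P H]
lemmas T_kernel = measurable_taboo_pow[OF P H]

lemma sets_K [measurable_cong]: "x \<in> space M \<Longrightarrow> sets (K x) = sets M"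
  using K_kernel by (rule sets_kernel)

lemma sets_T [measurable_cong]: "x \<in> space M \<Longrightarrow> sets (T t x) = sets M"
  using T_kernel by (rule sets_kernel)

lemma space_K: "x \<in> space M \<Longrightarrow> space (K x) = space M"
  by (intro sets_eq_imp_space_eq sets_K)

lemma space_T: "x \<in> space M \<Longrightarrow> space (T t x) = space M"
  by (intro sets_eq_imp_space_eq sets_T)

section \<open>Integration against the taboo kernel and its powers\<close>

lemma measurable_nn_integral_kernel:
  assumes "N \<in> M \<rightarrow>\<^sub>M subprob_algebra M" "f \<in> borel_measurable M"
  shows "(\<lambda>x. \<integral>\<^sup>+ y. f y \<partial>N x) \<in> borel_measurable M"
  using measurable_compose[OF assms(1) nn_integral_measurable_subprob_algebra[OF assms(2)]] .

lemma indicator_compl_measurable: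
  "(indicator (- H) :: _ \<Rightarrow> ennreal) \<in> borel_measurable M"
proof -
  have "- H \<inter> space M \<in> sets M" using H by (metis Diff_eq Int_commute sets.compl_sets)
  then show ?thesis by (simp add: borel_measurable_indicator_iff)
qed

lemma nn_integral_taboo:
  assumes N: "N \<in> M \<rightarrow>\<^sub>M subprob_algebra M" and x: "x \<in> space M" and f: "f \<in> borel_measurable M"
  shows "(\<integral>\<^sup>+ y. f y \<partial>taboo H N x) = (\<integral>\<^sup>+ y. indicator (- H) y * f y \<partial>N x)"
proof -
  have s: "sets (N x) = sets M" using N x by (rule sets_kernel)
  then have "(indicator (- H) :: _ \<Rightarrow> ennreal) \<in> borel_measurable (N x)"
    using indicator_compl_measurable by (simp cong: measurable_cong_sets)
  then show ?thesis
    unfolding taboo_def using f s by (intro nn_integral_density) (auto cong: measurable_cong_sets)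
qed

lemma nn_integral_T_0:
  assumes x: "x \<in> space M" and f: "f \<in> borel_measurable M"
  shows "(\<integral>\<^sup>+ y. f y \<partial>T 0 x) = indicator (- H) x * f x"
  unfolding taboo_pow.simps nn_integral_taboo[OF return_measurable x f]
  using x f indicator_compl_measurable by (intro nn_integral_return) auto

lemma nn_integral_T_Suc:
  assumes x: "x \<in> space M" and f: "f \<in> borel_measurable M"
  shows "(\<integral>\<^sup>+ y. f y \<partial>T (Suc t) x) = (\<integral>\<^sup>+ y. \<integral>\<^sup>+ z. f z \<partial>K y \<partial>T t x)"
  unfolding taboo_pow.simps using f
proof (rule nn_integral_bind)
  show "K \<in> T t x \<rightarrow>\<^sub>M subprob_algebra M"
    using K_kernel sets_T[OF x] by (simp cong: measurable_cong_sets)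
qed

lemma nn_integral_kernel_pow_Suc:
  assumes x: "x \<in> space M" and f: "f \<in> borel_measurable M"
  shows "(\<integral>\<^sup>+ y. f y \<partial>kernel_pow M P (Suc t) x) =
    (\<integral>\<^sup>+ y. \<integral>\<^sup>+ z. f z \<partial>P y \<partial>kernel_pow M P t x)"
  unfolding kernel_pow.simps using f
proof (rule nn_integral_bind)
  show "P \<in> kernel_pow M P t x \<rightarrow>\<^sub>M subprob_algebra M"
    using P sets_kernel[OF measurable_kernel_pow[OF P] x] by (simp cong: measurable_cong_sets)
qed

text \<open>The powers are built by appending a last step, whereas the equation for V_1 conditions
  on the first one; the two orders agree by induction. The start must lie outside \<open>H\<close>:
  from a point of \<open>H\<close> the left side vanishes, while the right side need not.\<close>

lemma nn_integral_T_first_step: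
  assumes x: "x \<in> space M - H" and f: "f \<in> borel_measurable M"
  shows "(\<integral>\<^sup>+ y. f y \<partial>T (Suc t) x) = (\<integral>\<^sup>+ y. \<integral>\<^sup>+ z. f z \<partial>T t y \<partial>K x)"
  using f
proof (induction t arbitrary: f)
  case 0
  note f = 0
  have xM: "x \<in> space M" using x by simp
  have i: "(\<lambda>y. indicator (- H) y * f y) \<in> borel_measurable M"
    using f indicator_compl_measurable by auto
  have "(\<integral>\<^sup>+ y. f y \<partial>T (Suc 0) x) = (\<integral>\<^sup>+ z. f z \<partial>K x)"
    unfolding nn_integral_T_Suc[OF xM f]
      nn_integral_T_0[OF xM measurable_nn_integral_kernel[OF K_kernel f]]
    using x by simp
  \<comment> \<open>The measure \<open>K x\<close> does not charge \<open>H\<close>, so the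
    indicator may be inserted; it is what integration against \<open>T 0 y\<close> produces.\<close>
  also have "\<dots> = (\<integral>\<^sup>+ y. indicator (- H) y * f y \<partial>K x)"
    unfolding nn_integral_taboo[OF P xM f] nn_integral_taboo[OF P xM i]
    by (intro nn_integral_cong) (auto split: split_indicator)
  also have "\<dots> = (\<integral>\<^sup>+ y. \<integral>\<^sup>+ z. f z \<partial>T 0 y \<partial>K x)"
    using nn_integral_T_0[OF _ f] space_K[OF xM] by (intro nn_integral_cong) simp
  finally show ?case .
next
  case (Suc t)
  have xM: "x \<in> space M" using x by simp
  have Kf: "(\<lambda>y. \<integral>\<^sup>+ z. f z \<partial>K y) \<in> borel_measurable M"
    by (intro measurable_nn_integral_kernel K_kernel Suc.prems)
  have "(\<integral>\<^sup>+ y. f y \<partial>T (Suc (Suc t)) x) = (\<integral>\<^sup>+ y. \<integral>\<^sup>+ w. \<integral>\<^sup>+ z. f z \<partial>K w \<partial>T t y \<partial>K x)"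
    unfolding nn_integral_T_Suc[OF xM Suc.prems] by (rule Suc.IH[OF Kf])
  also have "\<dots> = (\<integral>\<^sup>+ y. \<integral>\<^sup>+ z. f z \<partial>T (Suc t) y \<partial>K x)"
    using nn_integral_T_Suc[OF _ Suc.prems] space_K[OF xM] by (intro nn_integral_cong) simp
  finally show ?case .
qed

text \<open>The left side keeps only paths that avoid \<open>H\<close> up to time \<open>t\<close>,
  the right side all paths outside \<open>H\<close> at time \<open>t\<close>. General
  \<open>f\<close> is required because the induction step replaces \<open>f\<close> by its integral
  against \<open>K\<close>.\<close>

lemma nn_integral_T_le_kernel_pow:
  assumes x: "x \<in> space M" and f: "f \<in> borel_measurable M"
  shows "(\<integral>\<^sup>+ y. f y \<partial>T t x) \<le> (\<integral>\<^sup>+ y. indicator (- H) y * f y \<partial>kernel_pow M P t x)"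
  using f
proof (induction t arbitrary: f)
  case 0
  then show ?case by (simp add: nn_integral_taboo[OF return_measurable x])
next
  case (Suc t)
  note f = Suc.prems
  have sp: "space (kernel_pow M P t x) = space M"
    using sets_kernel[OF measurable_kernel_pow[OF P] x] by (rule sets_eq_imp_space_eq)
  have i: "(\<lambda>y. indicator (- H) y * f y) \<in> borel_measurable M"
    using f indicator_compl_measurable by auto
  have "(\<integral>\<^sup>+ y. f y \<partial>T (Suc t) x)
      \<le> (\<integral>\<^sup>+ y. indicator (- H) y * (\<integral>\<^sup>+ z. f z \<partial>K y) \<partial>kernel_pow M P t x)"
    unfolding nn_integral_T_Suc[OF x f]
    by (intro Suc.IH measurable_nn_integral_kernel K_kernel f)
  \<comment> \<open>The restriction at time \<open>t\<close> is forgotten by dropping the outer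
    indicator; the restriction at the next time moves from the kernel \<open>K\<close> into the
    integrand.\<close>
  also have "\<dots> \<le> (\<integral>\<^sup>+ y. \<integral>\<^sup>+ z. indicator (- H) z * f z \<partial>P y \<partial>kernel_pow M P t x)"
    using sp nn_integral_taboo[OF P _ f]
    by (intro nn_integral_mono) (auto split: split_indicator)
  also have "\<dots> = (\<integral>\<^sup>+ y. indicator (- H) y * f y \<partial>kernel_pow M P (Suc t) x)"
    by (rule nn_integral_kernel_pow_Suc[OF x i, symmetric])
  finally show ?case .
qed

section \<open>Avoidance probabilities and the series for V_1\<close>

lemma mass_eq_nn_integral: "x \<in> space M \<Longrightarrow> mass t x = (\<integral>\<^sup>+ y. 1 \<partial>T t x)"
  by (simp add: mass_def space_T)

lemma mass_measurable [measurable]: "mass t \<in> borel_measurable M"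
  unfolding mass_def by (intro measurable_emeasure_kernel[OF T_kernel]) auto

lemma mass_le_1: "x \<in> space M \<Longrightarrow> mass t x \<le> 1"
  using subprob_space.subprob_emeasure_le_1[OF subprob_space_kernel[OF T_kernel]]
  by (simp add: mass_def)

lemma mass_0: "x \<in> space M \<Longrightarrow> mass 0 x = indicator (- H) x"
  unfolding mass_eq_nn_integral by (subst nn_integral_T_0) auto

lemma mass_Suc:
  assumes x: "x \<in> space M - H"
  shows "mass (Suc t) x = (\<integral>\<^sup>+ y. mass t y \<partial>K x)"
proof -
  have xM: "x \<in> space M" using x by simp
  have "mass (Suc t) x = (\<integral>\<^sup>+ y. \<integral>\<^sup>+ z. 1 \<partial>T t y \<partial>K x)"
    unfolding mass_eq_nn_integral[OF xM] by (rule nn_integral_T_first_step[OF x]) simp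
  also have "\<dots> = (\<integral>\<^sup>+ y. mass t y \<partial>K x)"
    using space_K[OF xM] by (intro nn_integral_cong) (metis mass_eq_nn_integral)
  finally show ?thesis .
qed

text \<open>The zeroth taboo power is the null measure at points of \<open>H\<close>, and further
  steps keep it null. Hence the series for V_1 vanishes on \<open>H\<close> by itself and needs no
  case distinction.\<close>

lemma mass_eq_0:
  assumes "x \<in> H"
  shows "mass t x = 0"
proof -
  have x: "x \<in> space M" using assms H sets.sets_into_space by auto
  have "(\<integral>\<^sup>+ y. f y \<partial>T t x) = 0" if "f \<in> borel_measurable M" for f
    using that
  proof (induction t arbitrary: f)
    case 0
    then show ?case using assms by (simp add: nn_integral_T_0[OF x] del: taboo_pow.simps)
  next
    case (Suc t)
    then show ?case
      unfolding nn_integral_T_Suc[OF x Suc.prems]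
      by (intro Suc.IH measurable_nn_integral_kernel K_kernel)
  qed
  from this[of "\<lambda>_. 1"] show ?thesis unfolding mass_eq_nn_integral[OF x] by simp
qed

lemma V_eq_suminf: "V x = (\<Sum>t. c ^ t * mass t x)"
  using p1 by (simp add: V1_def mass_eq_0 ennreal_power flip: mass_def)

lemma V_eq_0: "x \<in> H \<Longrightarrow> V x = 0"
  by (simp add: V1_def)

lemma V_measurable [measurable]: "V \<in> borel_measurable M"
  unfolding V_eq_suminf[abs_def] by measurable

text \<open>The weights p (1 - p)^t form a probability distribution. This gives the bound 1/p on V_1
  and the total mass 1 in the estimate for part (b).\<close>

lemma geometric_c: "ennreal p * (\<Sum>t. c ^ t) = 1"
proof -
  have "c < 1"
    using p0 by (simp add: ennreal_less_one_iff)
  moreover have "1 - c = ennreal p"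
    using p1 by (simp add: ennreal_minus flip: ennreal_1)
  ultimately have "ennreal p * (\<Sum>t. c ^ t) = ennreal p * (1 / ennreal p)"
    by (simp add: suminf_geometric_ennreal)
  also have "\<dots> = 1"
    using p0 by (simp add: ennreal_times_divide)
  finally show ?thesis .
qed

lemma V_le: "x \<in> space M \<Longrightarrow> V x \<le> ennreal (1 / p)"
proof -
  assume x: "x \<in> space M"
  have "V x \<le> (\<Sum>t. c ^ t)"
    unfolding V_eq_suminf using mass_le_1[OF x]
    by (intro suminf_le) (auto simp: mult_left_le)
  also have "\<dots> = 1 / ennreal p"
    using geometric_c p0 by (metis ennreal_eq_0_iff ennreal_neq_top ennreal_mult_divide_eq
        mult.commute not_le)
  also have "\<dots> = ennreal (1 / p)"
    using p0 divide_ennreal[of 1 p] by simp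
  finally show ?thesis .
qed

lemma V_finite: "x \<in> space M \<Longrightarrow> V x < \<infinity>"
  using V_le by (metis ennreal_less_top infinity_ennreal_def le_less_trans)

section \<open>The equation for V_1 and comparison with supersolutions\<close>

lemma V_equation:
  assumes x: "x \<in> space M - H"
  shows "V x = 1 + c * (\<integral>\<^sup>+ y. V y \<partial>K x)"
proof -
  have xM: "x \<in> space M" using x by simp
  have "V x = mass 0 x + (\<Sum>t. c ^ Suc t * mass (Suc t) x)"
    unfolding V_eq_suminf by (subst suminf_offset[of _ 1]) auto
  also have "(\<Sum>t. c ^ Suc t * mass (Suc t) x) = c * (\<Sum>t. c ^ t * (\<integral>\<^sup>+ y. mass t y \<partial>K x))"
    unfolding mass_Suc[OF x] by (simp add: mult.assoc flip: ennreal_suminf_cmult)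
  \<comment> \<open>Sum and integral are interchanged by monotone convergence.\<close>
  also have "(\<Sum>t. c ^ t * (\<integral>\<^sup>+ y. mass t y \<partial>K x)) = (\<integral>\<^sup>+ y. V y \<partial>K x)"
    unfolding V_eq_suminf using xM
    by (simp add: nn_integral_suminf nn_integral_cmult)
  finally show ?thesis using x by (simp add: mass_0)
qed

text \<open>Each use of the inequality adds one more term of the series for V_1, multiplied by
  \<open>b\<close>, to the lower bound for \<open>W\<close>. The factor \<open>b\<close> may be
  infinite, so solutions with infinite \<nu>-integral are covered.\<close>

lemma V_minimal:
  assumes W: "\<And>x. x \<in> space M - H \<Longrightarrow> b + c * (\<integral>\<^sup>+ y. W y \<partial>K x) \<le> W x"
    and x: "x \<in> space M"
  shows "b * V x \<le> W x"
proof -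
  have "b * (\<Sum>t<n. c ^ t * mass t x) \<le> W x" for n
    using x
  proof (induction n arbitrary: x)
    case (Suc n)
    show ?case
    proof (cases "x \<in> H")
      case False
      then have x: "x \<in> space M - H" using Suc.prems by simp
      \<comment> \<open>The term at time 0 contributes \<open>b\<close>, since \<open>x\<close> lies
        outside \<open>H\<close>; every later term is rewritten by conditioning on the first
        step.\<close>
      have "b * (\<Sum>t<Suc n. c ^ t * mass t x)
          = b + c * (\<Sum>t<n. b * (c ^ t * (\<integral>\<^sup>+ y. mass t y \<partial>K x)))"
        unfolding sum.lessThan_Suc_shift mass_Suc[OF x] using x
        by (simp add: mass_0 distrib_left sum_distrib_left mult_ac)
      also have "(\<Sum>t<n. b * (c ^ t * (\<integral>\<^sup>+ y. mass t y \<partial>K x)))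
          = (\<integral>\<^sup>+ y. b * (\<Sum>t<n. c ^ t * mass t y) \<partial>K x)"
        using Suc.prems by (simp add: nn_integral_sum nn_integral_cmult sum_distrib_left)
      also have "\<dots> \<le> (\<integral>\<^sup>+ y. W y \<partial>K x)"
        using Suc.IH Suc.prems by (intro nn_integral_mono) (simp add: space_K)
      finally show ?thesis
        using W[OF x] by (meson add_left_mono mult_left_mono order_trans zero_le)
    qed (simp add: mass_eq_0)
  qed simp
  then show ?thesis
    unfolding V_eq_suminf ennreal_suminf_cmult[symmetric]
    by (intro suminf_le_ennreal) (simp add: sum_distrib_left)
qed

section \<open>The minimal solution of the hitting equation\<close>

lemma V_explicit_eq:
  "V_explicit M H P \<nu> p x = V x * (\<Sum>t. (ennreal p * (\<integral>\<^sup>+ y. V y \<partial>\<nu>)) ^ t)"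
  by (simp add: V_explicit_def V_eq_0)

lemma V_explicit_minimal:
  assumes \<nu> [measurable_cong]: "sets \<nu> = sets M"
  shows "minimal_solution M H P \<nu> p (V_explicit M H P \<nu> p)"
proof -
  define m where "m = ennreal p * (\<integral>\<^sup>+ y. V y \<partial>\<nu>)"
  define S where "S = (\<Sum>t. m ^ t)"
  have ex: "V_explicit M H P \<nu> p = (\<lambda>x. V x * S)"
    by (simp add: fun_eq_iff V_explicit_eq S_def m_def)
  \<comment> \<open>This form of the geometric series stays valid when \<open>m\<close> is at least
    1 and \<open>S\<close> is infinite.\<close>
  have S: "S = 1 + m * S"
    unfolding S_def by (subst suminf_offset[of _ 1]) (auto simp flip: ennreal_suminf_cmult)
  have sp: "space \<nu> = space M" using \<nu> by (rule sets_eq_imp_space_eq)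
  have "hitting_equation M H P \<nu> p (\<lambda>x. V x * S)"
    unfolding hitting_equation_def
  proof (intro conjI ballI)
    fix x assume x: "x \<in> space M - H"
    then have xM: "x \<in> space M" by simp
    \<comment> \<open>The constant part of the hitting equation is 1 + m S = S, so the equation for
      \<open>V * S\<close> is the one for \<open>V\<close> multiplied by \<open>S\<close>.\<close>
    have "1 + ennreal p * (\<integral>\<^sup>+ y. V y * S \<partial>\<nu>) = S"
      by (subst (2) S) (simp add: nn_integral_multc m_def mult.assoc)
    then show "V x * S = 1 + ennreal p * (\<integral>\<^sup>+ y. V y * S \<partial>\<nu>) + c * (\<integral>\<^sup>+ y. V y * S \<partial>K x)"
      using V_equation[OF x] xM by (simp add: nn_integral_multc distrib_right mult.assoc)
  qed (simp add: V_eq_0)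
  moreover have "V x * S \<le> W x" if eq: "hitting_equation M H P \<nu> p W" and x: "x \<in> space M" for W x
  proof -
    define b where "b = 1 + ennreal p * (\<integral>\<^sup>+ y. W y \<partial>\<nu>)"
    have bV: "b * V x \<le> W x" if "x \<in> space M" for x
      using eq that by (intro V_minimal) (simp_all add: hitting_equation_def b_def)
    have "b * m = ennreal p * (\<integral>\<^sup>+ y. b * V y \<partial>\<nu>)"
      by (simp add: m_def nn_integral_cmult mult_ac)
    also have "\<dots> \<le> ennreal p * (\<integral>\<^sup>+ y. W y \<partial>\<nu>)"
      using bV sp by (intro mult_left_mono nn_integral_mono) auto
    finally have step: "1 + b * m \<le> b" by (simp add: b_def)
    \<comment> \<open>Iterating 1 + b m \<le> b, instead of solving it for \<open>b\<close>, avoids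
      subtraction and division and so allows infinite \<open>b\<close>.\<close>
    have "(\<Sum>t<n. m ^ t) \<le> b" for n
    proof (induction n)
      case (Suc n)
      have "(\<Sum>t<Suc n. m ^ t) = 1 + (\<Sum>t<n. m ^ t) * m"
        by (simp add: sum.lessThan_Suc_shift sum_distrib_left mult.commute[of _ m] del: sum.lessThan_Suc)
      also have "\<dots> \<le> 1 + b * m"
        using Suc by (intro add_left_mono mult_right_mono) auto
      finally show ?case using step by simp
    qed simp
    then have "S \<le> b" unfolding S_def by (rule suminf_le_ennreal)
    then have "V x * S \<le> b * V x" by (subst mult.commute) (rule mult_right_mono, auto)
    then show ?thesis using bV[OF x] by simp
  qed
  ultimately show ?thesis unfolding minimal_solution_def ex by auto
qed

section \<open>Bounded solutions: existence and uniqueness\<close>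

lemma V_bounded_solution: "bounded_solution M H P p (\<lambda>x. enn2real (V x))"
  unfolding bounded_solution_def
proof (intro conjI ballI)
  show "bounded ((\<lambda>x. enn2real (V x)) ` space M)"
    unfolding bounded_iff using V_le p0
    by (intro exI[of _ "1 / p"]) (auto intro!: enn2real_leI)
next
  fix x assume x: "x \<in> space M - H"
  then have xM: "x \<in> space M" by simp
  have "(\<integral>y. enn2real (V y) \<partial>K x) = enn2real (\<integral>\<^sup>+ y. V y \<partial>K x)"
    using xM V_finite space_K[OF xM]
    by (subst integral_eq_nn_integral) (auto intro!: arg_cong[where f=enn2real] nn_integral_cong)
  \<comment> \<open>Finiteness matters because \<open>enn2real\<close> sends \<infinity> to 0 and
    hence is additive only on finite values.\<close>
  moreover have "c * (\<integral>\<^sup>+ y. V y \<partial>K x) < top"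
    using V_equation[OF x] V_finite[OF xM] by (auto simp: less_top)
  ultimately show "enn2real (V x) = 1 + (1 - p) * (\<integral>y. enn2real (V y) \<partial>K x)"
    using p1 by (simp add: V_equation[OF x] enn2real_plus enn2real_mult)
qed (simp_all add: V_eq_0)

lemma bounded_solution_unique:
  assumes U: "bounded_solution M H P p U" and W: "bounded_solution M H P p W"
    and x: "x \<in> space M"
  shows "U x = W x"
proof -
  obtain A where A: "\<And>x. x \<in> space M \<Longrightarrow> \<bar>U x\<bar> \<le> A"
    using U by (auto simp: bounded_solution_def bounded_iff)
  obtain B where B: "\<And>x. x \<in> space M \<Longrightarrow> \<bar>W x\<bar> \<le> B"
    using W by (auto simp: bounded_solution_def bounded_iff)
  have nonneg: "0 \<le> A" "0 \<le> B" using A[OF x] B[OF x] by auto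
  have [measurable]: "U \<in> borel_measurable M" "W \<in> borel_measurable M"
    using U W by (auto simp: bounded_solution_def)
  \<comment> \<open>The contraction is iterated pointwise, starting from the crude bound
    \<open>A + B\<close>; no supremum norm has to be formed.\<close>
  have bound: "\<bar>U x - W x\<bar> \<le> (1 - p) ^ n * (A + B)" if "x \<in> space M" for n x
    using that
  proof (induction n arbitrary: x)
    case 0
    then show ?case using A[of x] B[of x] by simp
  next
    case (Suc n)
    note x = Suc.prems
    note sub = subprob_space_kernel[OF K_kernel x]
    show ?case
    proof (cases "x \<in> H")
      case True
      then show ?thesis using U W nonneg p1 by (simp add: bounded_solution_def)
    next
      case False
      \<comment> \<open>Both functions must be integrable for the difference of the two Bochner
        integrals to be the integral of the difference.\<close>
      have "integrable (K x) U" "integrable (K x) W"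
        using integral_subprob_le(1)[OF sub, of U A] integral_subprob_le(1)[OF sub, of W B]
          A B nonneg x by (auto simp: space_K)
      then have "U x - W x = (1 - p) * (\<integral>y. U y - W y \<partial>K x)"
        using U W x False by (simp add: bounded_solution_def right_diff_distrib)
      moreover have "\<bar>\<integral>y. U y - W y \<partial>K x\<bar> \<le> (1 - p) ^ n * (A + B)"
        using Suc.IH nonneg p1 x by (intro integral_subprob_le(2)[OF sub]) (auto simp: space_K)
      ultimately show ?thesis
        using p1 by (simp add: abs_mult mult.assoc mult_left_mono)
    qed
  qed
  have "(\<lambda>n. (1 - p) ^ n * (A + B)) \<longlonglongrightarrow> 0 * (A + B)"
    using p0 p1 by (intro tendsto_mult_right LIMSEQ_realpow_zero) auto
  then have "\<bar>U x - W x\<bar> \<le> 0 * (A + B)"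
    using bound[OF x] by (intro LIMSEQ_le_const) auto
  then show ?thesis by simp
qed

section \<open>Positive restart measure of \<open>H\<close> and the closed form\<close>

lemma restart_measure_plus_V_le_1:
  assumes \<nu> [measurable_cong]: "sets \<nu> = sets M" and "prob_space \<nu>"
  shows "emeasure (restart_measure M P \<nu> p) H + ennreal p * (\<integral>\<^sup>+ y. V y \<partial>\<nu>) \<le> 1"
proof -
  interpret prob_space \<nu> by fact
  let ?h = "\<lambda>t y. emeasure (kernel_pow M P t y) H"
  have sp: "space \<nu> = space M" using \<nu> by (rule sets_eq_imp_space_eq)
  have meas: "?h t \<in> borel_measurable M" for t
    by (intro measurable_emeasure_kernel[OF measurable_kernel_pow[OF P] H])
  \<comment> \<open>Being in \<open>H\<close> at time \<open>t\<close> and having avoided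
    \<open>H\<close> up to time \<open>t\<close> are disjoint events.\<close>
  have le: "?h t y + mass t y \<le> 1" if y: "y \<in> space M" for t y
  proof -
    let ?Q = "kernel_pow M P t y"
    interpret Q: subprob_space ?Q
      using measurable_kernel_pow[OF P] y by (rule subprob_space_kernel)
    have s: "sets ?Q = sets M" using measurable_kernel_pow[OF P] y by (rule sets_kernel)
    then have spQ: "space ?Q = space M" by (rule sets_eq_imp_space_eq)
    have "mass t y \<le> (\<integral>\<^sup>+ z. indicator (- H) z * 1 \<partial>?Q)"
      unfolding mass_eq_nn_integral[OF y] by (intro nn_integral_T_le_kernel_pow y) simp
    also have "\<dots> = (\<integral>\<^sup>+ z. indicator (space M - H) z \<partial>?Q)"
      by (intro nn_integral_cong) (auto simp: spQ split: split_indicator)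
    also have "\<dots> = emeasure ?Q (space M - H)"
      using s H by (intro nn_integral_indicator) auto
    finally have "?h t y + mass t y \<le> ?h t y + emeasure ?Q (space M - H)"
      by (rule add_left_mono)
    also have "\<dots> = emeasure ?Q (H \<union> (space M - H))"
      using s H by (intro plus_emeasure) auto
    also have "\<dots> \<le> 1" by (rule Q.subprob_emeasure_le_1)
    finally show ?thesis .
  qed
  have q: "emeasure (restart_measure M P \<nu> p) H
      = (\<integral>\<^sup>+ y. ennreal p * (\<Sum>t. c ^ t * ?h t y) \<partial>\<nu>)"
    unfolding emeasure_restart_measure[OF P \<nu> H] using p0 p1
    by (simp add: ennreal_mult ennreal_power mult.assoc)
  have [measurable]: "?h t \<in> borel_measurable \<nu>" for t
    using meas \<nu> by (simp cong: measurable_cong_sets)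
  have "emeasure (restart_measure M P \<nu> p) H + ennreal p * (\<integral>\<^sup>+ y. V y \<partial>\<nu>)
      = (\<integral>\<^sup>+ y. ennreal p * (\<Sum>t. c ^ t * ?h t y) + ennreal p * V y \<partial>\<nu>)"
    unfolding q by (simp add: nn_integral_add nn_integral_cmult)
  also have "\<dots> \<le> (\<integral>\<^sup>+ y. 1 \<partial>\<nu>)"
  proof (rule nn_integral_mono)
    fix y assume "y \<in> space \<nu>"
    then have y: "y \<in> space M" using sp by simp
    \<comment> \<open>Both terms are mixtures over \<open>t\<close> with the same geometric weights,
      so the previous bound applies time by time.\<close>
    have "ennreal p * (\<Sum>t. c ^ t * ?h t y) + ennreal p * V y
        = ennreal p * (\<Sum>t. c ^ t * (?h t y + mass t y))"
      unfolding V_eq_suminf by (simp add: distrib_left suminf_add[symmetric])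
    also have "\<dots> \<le> ennreal p * (\<Sum>t. c ^ t)"
      using le[OF y] by (intro mult_left_mono suminf_le) (auto simp: mult_left_le)
    finally show "ennreal p * (\<Sum>t. c ^ t * ?h t y) + ennreal p * V y \<le> 1"
      using geometric_c by simp
  qed
  finally show ?thesis by (simp add: emeasure_space_1)
qed

lemma minimal_solution_eq:
  assumes \<nu>: "sets \<nu> = sets M" "prob_space \<nu>"
    and q: "0 < emeasure (restart_measure M P \<nu> p) H"
    and W: "minimal_solution M H P \<nu> p W" and x: "x \<in> space M"
  shows "W x = V x / (1 - ennreal p * (\<integral>\<^sup>+ y. V y \<partial>\<nu>))" and "W x < \<infinity>"
proof -
  define m where "m = ennreal p * (\<integral>\<^sup>+ y. V y \<partial>\<nu>)"
  have le: "emeasure (restart_measure M P \<nu> p) H + m \<le> 1"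
    unfolding m_def by (rule restart_measure_plus_V_le_1[OF \<nu>])
  \<comment> \<open>Otherwise q(H) + 1 \<le> 1, and cancelling the finite term 1 would force q(H) =
    0.\<close>
  have m: "m < 1"
  proof (rule ccontr)
    assume "\<not> m < 1"
    then have "emeasure (restart_measure M P \<nu> p) H + 1 \<le> 0 + 1"
      using le by (metis add_left_mono add_0 not_less order_trans)
    then show False
      using q by (simp add: ennreal_add_left_cancel_le add.commute[of _ 1] del: add_0)
  qed
  \<comment> \<open>Two minimal solutions lie below each other, hence agree on the space.\<close>
  have "W x = V_explicit M H P \<nu> p x"
    using W V_explicit_minimal[OF \<nu>(1)] x unfolding minimal_solution_def
    by (meson order_antisym)
  also have "\<dots> = V x * (1 / (1 - m))"
    unfolding V_explicit_eq m_def[symmetric] suminf_geometric_ennreal[OF m] ..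
  also have "\<dots> = V x / (1 - m)"
    by (simp add: divide_ennreal_def)
  finally have eq: "W x = V x / (1 - m)" .
  then show "W x = V x / (1 - ennreal p * (\<integral>\<^sup>+ y. V y \<partial>\<nu>))" by (simp add: m_def)
  \<comment> \<open>A zero denominator would make the quotient infinite wherever V_1 is
    positive.\<close>
  have "1 - m \<noteq> 0" using m by (simp add: diff_eq_0_iff_ennreal)
  then show "W x < \<infinity>"
    using V_finite[OF x] unfolding eq
    by (metis ennreal_divide_eq_top_iff infinity_ennreal_def less_top)
qed

end

section \<open>Specialisation to a stochastic kernel on a locally compact Borel space\<close>

theorem theorem2p1:
  fixes E H :: "'a::polish_space set"
    and M :: "'a measure"
    and P :: "'a \<Rightarrow> 'a measure"
    and \<nu> :: "'a measure"
    and p :: real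
  assumes "E \<in> sets borel" and "E \<noteq> {}" and "locally compact E"
    and M: "M = restrict_space borel E"
    and "P \<in> M \<rightarrow>\<^sub>M prob_algebra M"
    and "prob_space \<nu>" and "sets \<nu> = sets M"
    and "0 < p" and "p < 1"
    and "H \<in> sets M"
  shows
    "minimal_solution M H P \<nu> p (V_explicit M H P \<nu> p) \<and>
     (\<forall>x\<in>E. V1 M H P p x < \<infinity>) \<and>
     bounded_solution M H P p (\<lambda>x. enn2real (V1 M H P p x)) \<and>
     (\<forall>W. bounded_solution M H P p W \<longrightarrow> (\<forall>x\<in>E. W x = enn2real (V1 M H P p x))) \<and>
     (emeasure (restart_measure M P \<nu> p) H > 0 \<longrightarrow>
       (\<forall>V. minimal_solution M H P \<nu> p V \<longrightarrow>
          (\<forall>x\<in>E - H. V x = V1 M H P p x / (1 - ennreal p * (\<integral>\<^sup>+ y. V1 M H P p y \<partial>\<nu>)) \<and> V x < \<infinity>) \<and>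
          (\<forall>x\<in>H. V x = 0)))"
proof -
  interpret restart_chain M H P p
    using assms by unfold_locales (auto intro: measurable_prob_algebraD)
  have sp: "space M = E" using M by (simp add: space_restrict_space)
  have W0: "\<forall>x\<in>H. W x = 0" if "minimal_solution M H P \<nu> p W" for W
    using that by (simp add: minimal_solution_def hitting_equation_def)
  show ?thesis
    using V_explicit_minimal[OF \<open>sets \<nu> = sets M\<close>] V_finite V_bounded_solution
      bounded_solution_unique[OF _ V_bounded_solution]
      minimal_solution_eq[OF \<open>sets \<nu> = sets M\<close> \<open>prob_space \<nu>\<close>] W0
    unfolding sp by auto
qed

end
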